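(* There is a constant $c>0$ such that for every integer $d \geqslant 0$ there exists an integer $k_0 = k_0(d) \geqslant 1$ such that for every integer $k \geqslant k_0$ there are a bipartite graph $G$ of twin-width at most $d$ and a set $X \subseteq V(G)$ with $|X| = k$ such that the number of distinct $X$-neighbourhoods in $G$, that is, $|\{N_G(v)\cap X \mid v \in V(G)\}|$, is at least $c \cdot d\,2^d |X|$ (and, for $d \geqslant 1$, $c\cdot d\,2^d|X| = 2^{d+\log d+\Theta(1)}|X|$).
   Context: Graphs are finite, simple and undirected. $N_G(v)$ denotes the (open) neighbourhood of $v$ in $G$. For $X \subseteq V(G)$, an $X$-neighbourhood is a set $N_G(v) \cap X$ for some $v \in V(G)$ (vertices $v\in X$ are allowed). The logarithm is in base 2, and $\Theta(1)$ in the exponent denotes a quantity bounded in absolute value by an absolute constant. Trigraphs: a trigraph is a triple $G=(V(G),E(G),R(G))$ where $E(G)$ and $R(G)$ are disjoint sets of edges (unordered pairs of distinct vertices) on $V(G)$, called black edges and red edges respectively. The red degree of a trigraph is the maximum degree of the graph $(V(G),R(G))$. Any graph $G$ is viewed as the trigraph $(V(G),E(G),\emptyset)$. Contraction: given a trigraph $G$ and two distinct vertices $u,v \in V(G)$ (not necessarily adjacent), the contraction $G' = G/u,v$ is the trigraph with vertex set $V(G') = \{w\} \cup (V(G)\setminus\{u,v\})$, where $w$ is a new vertex, such that the (black and red) edges between vertices of $V(G)\setminus\{u,v\}$ are the same as in $G$, and for each $x \in V(G)\setminus\{u,v\}$: $wx \in E(G')$ if $xu \in E(G)$ and $xv \in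 E(G)$; $wx \notin E(G')\cup R(G')$ if $xu \notin E(G)\cup R(G)$ and $xv \notin E(G)\cup R(G)$; and $wx \in R(G')$ otherwise. Twin-width: a $d$-sequence of an $n$-vertex graph $G$ is a sequence of $n$ trigraphs $G=G_n, G_{n-1},\ldots,G_1$ such that each $G_i$ with $i<n$ is obtained from $G_{i+1}$ by a contraction, and each $G_i$ has red degree at most $d$. The twin-width of $G$ is the minimum integer $d$ such that $G$ admits a $d$-sequence. *)

theory Defs
  imports Complex_Main "HOL-Library.Infinite_Typeclass"
begin

record 'a graph =
  verts :: "'a set"
  edges :: "'a set set"

definition simple_graph :: "'a graph \<Rightarrow> bool" where
  "simple_graph G \<longleftrightarrow> finite (verts G) \<and> (\<forall>e\<in>edges G. e \<subseteq> verts G \<and> card e = 2)"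

definition bipartite :: "'a graph \<Rightarrow> bool" where
  "bipartite G \<longleftrightarrow> (\<exists>A B. A \<union> B = verts G \<and> A \<inter> B = {} \<and>
     (\<forall>e\<in>edges G. \<exists>a\<in>A. \<exists>b\<in>B. e = {a, b}))"

definition nbhd :: "'a graph \<Rightarrow> 'a \<Rightarrow> 'a set" where
  "nbhd G v = {u \<in> verts G. {v, u} \<in> edges G}"

definition nbhds_on :: "'a graph \<Rightarrow> 'a set \<Rightarrow> 'a set set" where
  "nbhds_on G X = {nbhd G v \<inter> X | v. v \<in> verts G}"

record 'a trigraph =
  tverts :: "'a set"
  black :: "'a set set"
  red :: "'a set set"

definition is_trigraph :: "'a trigraph \<Rightarrow> bool" where
  "is_trigraph T \<longleftrightarrow> finite (tverts T) \<and>
     (\<forall>e \<in> black T \<union> red T. e \<subseteq> tverts T \<and> card e = 2) \<and> black T \<inter> red T = {}"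

definition trigraph_of :: "'a graph \<Rightarrow> 'a trigraph" where
  "trigraph_of G = \<lparr>tverts = verts G, black = edges G, red = {}\<rparr>"

text \<open>The maximum is taken over the vertices, so the value is unspecified for a trigraph
  without vertices; no such trigraph occurs in a contraction sequence.\<close>

definition red_degree :: "'a trigraph \<Rightarrow> nat" where
  "red_degree T = Max ((\<lambda>v. card {x \<in> tverts T. {v, x} \<in> red T}) ` tverts T)"

text \<open>The contraction of \<open>u\<close> and \<open>v\<close>, with \<open>w\<close> as the name of the new vertex.\<close>

definition contract :: "'a trigraph \<Rightarrow> 'a \<Rightarrow> 'a \<Rightarrow> 'a \<Rightarrow> 'a trigraph" where
  "contract T u v w = (let W = tverts T - {u, v} in
     \<lparr>tverts = insert w W,
      black = {e \<in> black T. e \<subseteq> W} \<union>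
        {{w, x} | x. x \<in> W \<and> {x, u} \<in> black T \<and> {x, v} \<in> black T},
      red = {e \<in> red T. e \<subseteq> W} \<union>
        {{w, x} | x. x \<in> W \<and> \<not> ({x, u} \<in> black T \<and> {x, v} \<in> black T) \<and>
           \<not> ({x, u} \<notin> black T \<union> red T \<and> {x, v} \<notin> black T \<union> red T)}\<rparr>)"

definition is_contraction :: "'a trigraph \<Rightarrow> 'a trigraph \<Rightarrow> bool" where
  "is_contraction T T' \<longleftrightarrow> (\<exists>u v w. u \<in> tverts T \<and> v \<in> tverts T \<and> u \<noteq> v \<and>
     w \<notin> tverts T \<and> T' = contract T u v w)"

text \<open>Only the values \<open>S i\<close> with \<open>1 \<le> i \<le> n\<close> form the sequence, \<open>n\<close> being the number of
  vertices of the graph.\<close>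

definition d_sequence :: "nat \<Rightarrow> 'a graph \<Rightarrow> (nat \<Rightarrow> 'a trigraph) \<Rightarrow> bool" where
  "d_sequence d G S \<longleftrightarrow> (let n = card (verts G) in
     S n = trigraph_of G \<and>
     (\<forall>i\<in>{1..<n}. is_contraction (S (i + 1)) (S i)) \<and>
     (\<forall>i\<in>{1..n}. is_trigraph (S i) \<and> red_degree (S i) \<le> d))"

text \<open>An infinite vertex type guarantees that fresh vertices exist, so that every finite
  graph admits a contraction sequence (\<open>d_sequence_exists\<close> below) and the minimum is attained.\<close>

definition twin_width :: "'a::infinite graph \<Rightarrow> nat" where
  "twin_width G = (LEAST d. \<exists>S. d_sequence d G S)"

lemma is_trigraph_trigraph_of: "simple_graph G \<Longrightarrow> is_trigraph (trigraph_of G)"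
  by (auto simp: simple_graph_def is_trigraph_def trigraph_of_def)

lemma is_trigraph_contract:
  assumes "is_trigraph T" "w \<notin> tverts T"
  shows "is_trigraph (contract T u v w)"
  unfolding is_trigraph_def
proof (intro conjI)
  show "finite (tverts (contract T u v w))"
    using assms by (auto simp: is_trigraph_def contract_def Let_def)
  show "\<forall>e \<in> black (contract T u v w) \<union> red (contract T u v w).
      e \<subseteq> tverts (contract T u v w) \<and> card e = 2"
    using assms by (auto simp: is_trigraph_def contract_def Let_def card_insert_if)
  show "black (contract T u v w) \<inter> red (contract T u v w) = {}"
    using assms by (auto simp: is_trigraph_def contract_def Let_def doubleton_eq_iff)
qed

lemma card_tverts_contract:
  assumes "finite (tverts T)" "u \<in> tverts T" "v \<in> tverts T" "u \<noteq> v" "w \<notin> tverts T"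
  shows "Suc (card (tverts (contract T u v w))) = card (tverts T)"
proof -
  have "card {u, v} \<le> card (tverts T)" using assms by (intro card_mono) auto
  then show ?thesis using assms by (simp add: contract_def Let_def card_Diff_subset)
qed

lemma red_degree_le_card:
  assumes "is_trigraph T" "tverts T \<noteq> {}"
  shows "red_degree T \<le> card (tverts T)"
  using assms by (auto simp: red_degree_def is_trigraph_def intro: card_mono)

lemma contraction_sequence_exists:
  fixes T :: "'a::infinite trigraph"
  assumes "is_trigraph T" "card (tverts T) = n"
  shows "\<exists>S. S n = T \<and> (\<forall>i\<in>{1..<n}. is_contraction (S (i + 1)) (S i)) \<and>
    (\<forall>i\<in>{1..n}. is_trigraph (S i) \<and> card (tverts (S i)) = i)"
  using assms
proof (induction n arbitrary: T)
  case 0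
  then show ?case by auto
next
  case (Suc n)
  show ?case
  proof (cases "n = 0")
    case True
    then show ?thesis using Suc.prems by (intro exI[of _ "\<lambda>_. T"]) auto
  next
    case False
    have fin: "finite (tverts T)" using Suc.prems by (simp add: is_trigraph_def)
    obtain u where u: "u \<in> tverts T" using Suc.prems by fastforce
    have "card (tverts T - {u}) \<noteq> 0" using u fin Suc.prems False by simp
    then have "tverts T - {u} \<noteq> {}" by force
    then obtain v where v: "v \<in> tverts T" "u \<noteq> v" by blast
    obtain w where w: "w \<notin> tverts T" using fin ex_new_if_finite infinite_UNIV by blast
    let ?T = "contract T u v w"
    have wf: "is_trigraph ?T" using Suc.prems(1) w by (rule is_trigraph_contract)
    have cd: "card (tverts ?T) = n"
      using card_tverts_contract[OF fin u v w] Suc.prems by simp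
    obtain S where S: "S n = ?T" "\<forall>i\<in>{1..<n}. is_contraction (S (i + 1)) (S i)"
      "\<forall>i\<in>{1..n}. is_trigraph (S i) \<and> card (tverts (S i)) = i"
      using Suc.IH[OF wf cd] by blast
    have "is_contraction T ?T" using u v w by (auto simp: is_contraction_def)
    then show ?thesis using S Suc.prems
      by (intro exI[of _ "S(Suc n := T)"]) (auto simp: less_Suc_eq le_Suc_eq)
  qed
qed

lemma d_sequence_exists:
  fixes G :: "'a::infinite graph"
  assumes "simple_graph G"
  shows "\<exists>d S. d_sequence d G S"
proof -
  let ?n = "card (verts G)"
  have c: "card (tverts (trigraph_of G)) = ?n" by (simp add: trigraph_of_def)
  obtain S where S: "S ?n = trigraph_of G"
    "\<forall>i\<in>{1..<?n}. is_contraction (S (i + 1)) (S i)"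
    "\<forall>i\<in>{1..?n}. is_trigraph (S i) \<and> card (tverts (S i)) = i"
    using contraction_sequence_exists[OF is_trigraph_trigraph_of[OF assms] c] by blast
  have "red_degree (S i) \<le> ?n" if "i \<in> {1..?n}" for i
  proof -
    have i: "is_trigraph (S i)" "card (tverts (S i)) = i" using S(3) that by auto
    then have "tverts (S i) \<noteq> {}" using that by auto
    then show ?thesis using red_degree_le_card[OF i(1)] i(2) that by auto
  qed
  then have "d_sequence ?n G S" using S by (simp add: d_sequence_def Let_def)
  then show ?thesis by blast
qed

lemma twin_width_le: "d_sequence d G S \<Longrightarrow> twin_width G \<le> d"
  unfolding twin_width_def by (rule Least_le) blast

end

theory Submission
  imports Defs
begin

text \<open>
  The lower bound comes from a sliding window over a line of columns, repeated \<open>d\<close> times.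
  Put base columns \<open>Base 0, \<dots>, Base (m - 1)\<close> and \<open>d\<close> marker columns into \<open>X\<close>, so that
  \<open>k = m + d\<close>. For every position \<open>i < m - d\<close>, every \<open>j < d\<close> and every set
  \<open>S\<close> of positions in the window \<open>{i + 2..<i + d}\<close>, one vertex \<open>Row i j S\<close> is joined to the
  base columns up to \<open>i\<close>, to those in \<open>S\<close>, and to the marker \<open>j\<close>. The neighbourhood of a row
  in \<open>X\<close> determines the row: the marker gives \<open>j\<close>; since \<open>i + 1\<close> is never a neighbour, \<open>i\<close> is
  the end of the initial run; the rest is \<open>S\<close> (\<open>inj_on_row_traces\<close>).
  The number of rows is \<open>(m - d) d 2\<^sup>d\<^sup>-\<^sup>2\<close> for \<open>d \<ge> 2\<close>, and \<open>m - d \<ge> k / 2\<close> once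
  \<open>k \<ge> 4 d\<close>. Windows at different positions provide the factor \<open>k\<close>, subsets of a window the
  factor \<open>2\<^sup>d\<close>. The markers provide the factor \<open>d\<close> almost for free: they enlarge \<open>X\<close> only by
  the constant \<open>d\<close>, and rows with the same marker are never told apart by a marker.

  The twin-width is at most \<open>d\<close> because the graph can be swept from left to right
  (\<open>bagging_degree\<close>). Columns are contracted into one bag, and the rows of each \<open>j\<close> into a bag of
  their own, in the order \<open>Base 0\<close>, rows at \<open>0\<close>, \<open>Base 1\<close>, rows at \<open>1\<close>, and so on, with the
  markers at the end. A row waiting its turn is joined to all of the column bag, so the column
  bag, like every single column, has red edges only to the \<open>d\<close> row bags. A row bag disagrees only
  on the column bag and on the single columns that some swept window reaches. If \<open>i\<^sub>0\<close> is the first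
  base column that is still single, the swept rows have positions below \<open>i\<^sub>0\<close>, and their windows
  end before \<open>i\<^sub>0 + d - 1\<close>, which leaves at most \<open>d - 1\<close> such columns. Finally only \<open>d + 1\<close>
  bags are left, and a trigraph with so few vertices has red degree at most \<open>d\<close> whatever is
  contracted.

  To avoid bookkeeping of fresh vertex names, all trigraphs of the sequence are described
  as quotients of the graph under a labelling of its vertices. The red degree depends only on the
  partition into label classes (\<open>red_degree_quotient_le\<close>), a contraction amounts to giving two
  classes a common label (\<open>contract_quotient\<close>), and \<open>reducible_by_bagging\<close> turns a rank-ordered
  filling of bags into a contraction sequence.
\<close>

section \<open>Quotient trigraphs\<close>

definition linked :: "'v set \<Rightarrow> ('v \<Rightarrow> 'v \<Rightarrow> bool) \<Rightarrow> ('v \<Rightarrow> 'b) \<Rightarrow> 'b \<Rightarrow> 'b \<Rightarrow> bool" where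
  "linked V r f a b \<longleftrightarrow> (\<exists>u\<in>V. \<exists>v\<in>V. f u = a \<and> f v = b \<and> r u v)"

definition mixed :: "'v set \<Rightarrow> ('v \<Rightarrow> 'v \<Rightarrow> bool) \<Rightarrow> ('v \<Rightarrow> 'b) \<Rightarrow> 'b \<Rightarrow> 'b \<Rightarrow> bool" where
  "mixed V r f a b \<longleftrightarrow> linked V r f a b \<and> linked V (\<lambda>u v. \<not> r u v) f a b"

text \<open>
  Two label classes are joined by a black edge if all pairs across them are related, and by a
  red one if some are and some are not.
\<close>

definition quotient :: "'v set \<Rightarrow> ('v \<Rightarrow> 'v \<Rightarrow> bool) \<Rightarrow> ('v \<Rightarrow> 'a) \<Rightarrow> 'a trigraph" where
  "quotient V r f = \<lparr>tverts = f ` V,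
     black = {{a, b} | a b. a \<in> f ` V \<and> b \<in> f ` V \<and> a \<noteq> b \<and> \<not> linked V (\<lambda>u v. \<not> r u v) f a b},
     red = {{a, b} | a b. a \<in> f ` V \<and> b \<in> f ` V \<and> a \<noteq> b \<and> mixed V r f a b}\<rparr>"

lemma linked_sym:
  assumes "symp r"
  shows "linked V r f a b \<longleftrightarrow> linked V r f b a"
  unfolding linked_def using assms[unfolded symp_def] by blast

lemma symp_not: "symp r \<Longrightarrow> symp (\<lambda>u v. \<not> r u v)"
  unfolding symp_def by blast

lemma mixed_sym:
  assumes "symp r"
  shows "mixed V r f a b \<longleftrightarrow> mixed V r f b a"
  unfolding mixed_def linked_sym[OF assms, of V f a b]
    linked_sym[OF symp_not[OF assms], of V f a b] ..

lemma tverts_quotient [simp]: "tverts (quotient V r f) = f ` V"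
  by (simp add: quotient_def)

lemma doubleton_mem_iff:
  assumes sym: "\<And>x y. P x y \<Longrightarrow> P y x"
  shows "{a, b} \<in> {{x, y} | x y. P x y} \<longleftrightarrow> P a b"
proof
  assume "{a, b} \<in> {{x, y} | x y. P x y}"
  then obtain x y where xy: "{a, b} = {x, y}" "P x y" by blast
  then show "P a b" using sym[OF xy(2)] unfolding doubleton_eq_iff by blast
qed blast

lemma black_quotient_iff:
  assumes "symp r"
  shows "{a, b} \<in> black (quotient V r f) \<longleftrightarrow>
    a \<in> f ` V \<and> b \<in> f ` V \<and> a \<noteq> b \<and> \<not> linked V (\<lambda>u v. \<not> r u v) f a b"
  unfolding quotient_def trigraph.select_convs
  by (rule doubleton_mem_iff) (simp add: linked_sym[OF symp_not[OF assms]]; blast)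

lemma red_quotient_iff:
  assumes "symp r"
  shows "{a, b} \<in> red (quotient V r f) \<longleftrightarrow>
    a \<in> f ` V \<and> b \<in> f ` V \<and> a \<noteq> b \<and> mixed V r f a b"
  unfolding quotient_def trigraph.select_convs
  by (rule doubleton_mem_iff) (simp add: mixed_sym[OF assms]; blast)

lemma is_trigraph_quotient:
  assumes "finite V" "symp r"
  shows "is_trigraph (quotient V r f)"
  unfolding is_trigraph_def
proof (intro conjI)
  show "finite (tverts (quotient V r f))" using assms by simp
  show "\<forall>e\<in>black (quotient V r f) \<union> red (quotient V r f).
      e \<subseteq> tverts (quotient V r f) \<and> card e = 2"
    by (auto simp: quotient_def)
  have "e \<notin> red (quotient V r f)" if e: "e \<in> black (quotient V r f)" for e
  proof -
    obtain a b where "e = {a, b}" using e by (auto simp: quotient_def)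
    then show ?thesis using e assms(2)
      by (simp add: black_quotient_iff red_quotient_iff mixed_def)
  qed
  then show "black (quotient V r f) \<inter> red (quotient V r f) = {}" by blast
qed

lemma quotient_cong: "(\<And>v. v \<in> V \<Longrightarrow> f v = g v) \<Longrightarrow> quotient V r f = quotient V r g"
proof -
  assume fg: "\<And>v. v \<in> V \<Longrightarrow> f v = g v"
  have "linked V s f = linked V s g" for s
    unfolding linked_def using fg by (intro ext) (metis (no_types))
  moreover have "f ` V = g ` V" using fg by simp
  ultimately show ?thesis by (simp add: quotient_def mixed_def)
qed

text \<open>
  Edges of a trigraph are pairs of distinct vertices, so it suffices to compare membership of
  such pairs.
\<close>

lemma trigraph_eqI:
  fixes T T' :: "'a trigraph"
  assumes T: "is_trigraph T" "is_trigraph T'" and tv: "tverts T = tverts T'"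
    and eq: "\<And>x y. x \<in> tverts T \<Longrightarrow> y \<in> tverts T \<Longrightarrow> x \<noteq> y \<Longrightarrow>
      ({x, y} \<in> black T \<longleftrightarrow> {x, y} \<in> black T') \<and> ({x, y} \<in> red T \<longleftrightarrow> {x, y} \<in> red T')"
  shows "T = T'"
proof -
  have ed: "\<exists>x y. e = {x, y} \<and> x \<in> tverts T \<and> y \<in> tverts T \<and> x \<noteq> y"
    if "e \<in> black T \<union> red T \<union> black T' \<union> red T'" for e
  proof -
    have "e \<subseteq> tverts T" "card e = 2" using that T tv by (auto simp: is_trigraph_def)
    then show ?thesis by (auto simp: card_2_iff)
  qed
  have "black T = black T'" "red T = red T'"
    using ed eq by blast+
  with tv show ?thesis by simp
qed

lemma contract_old:
  assumes "x \<in> tverts T - {a, b}" "y \<in> tverts T - {a, b}" "w \<notin> tverts T"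
  shows "{x, y} \<in> black (contract T a b w) \<longleftrightarrow> {x, y} \<in> black T"
    and "{x, y} \<in> red (contract T a b w) \<longleftrightarrow> {x, y} \<in> red T"
proof -
  have "{x, y} \<noteq> {w, z}" for z using assms by (auto simp: doubleton_eq_iff)
  then show "{x, y} \<in> black (contract T a b w) \<longleftrightarrow> {x, y} \<in> black T"
    "{x, y} \<in> red (contract T a b w) \<longleftrightarrow> {x, y} \<in> red T"
    unfolding contract_def Let_def using assms(1,2) by simp_all
qed

lemma contract_new:
  assumes "x \<in> tverts T - {a, b}" "w \<notin> tverts T"
  shows "{w, x} \<in> black (contract T a b w) \<longleftrightarrow> {a, x} \<in> black T \<and> {b, x} \<in> black T"
    and "{w, x} \<in> red (contract T a b w) \<longleftrightarrow>
      \<not> ({a, x} \<in> black T \<and> {b, x} \<in> black T) \<and>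
      ({a, x} \<in> black T \<union> red T \<or> {b, x} \<in> black T \<union> red T)"
proof -
  have "{w, x} = {w, z} \<longleftrightarrow> z = x" for z using assms by (auto simp: doubleton_eq_iff)
  moreover have "\<not> {w, x} \<subseteq> tverts T - {a, b}" using assms by simp
  ultimately show "{w, x} \<in> black (contract T a b w) \<longleftrightarrow> {a, x} \<in> black T \<and> {b, x} \<in> black T"
    "{w, x} \<in> red (contract T a b w) \<longleftrightarrow>
      \<not> ({a, x} \<in> black T \<and> {b, x} \<in> black T) \<and>
      ({a, x} \<in> black T \<union> red T \<or> {b, x} \<in> black T \<union> red T)"
    unfolding contract_def Let_def using assms by (simp_all add: insert_commute)
qed

text \<open>
  The rule for red and black edges at a contracted vertex says exactly that the class of the new
  vertex is the union of the two old classes: a pair of classes is completely joined iff both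
  old pairs are, and completely unjoined iff both are.
\<close>

lemma contract_quotient:
  assumes V: "finite V" and sym: "symp r" and a: "a \<in> f ` V" and b: "b \<in> f ` V"
    and ab: "a \<noteq> b" and w: "w \<notin> f ` V"
  shows "contract (quotient V r f) a b w =
    quotient V r (\<lambda>v. if f v \<in> {a, b} then w else f v)"
proof -
  define g where "g v = (if f v \<in> {a, b} then w else f v)" for v
  define W where "W = f ` V - {a, b}"
  let ?Q = "quotient V r f"
  have im: "g ` V = insert w W" using a by (auto simp: g_def W_def)
  have gW: "g v = y \<longleftrightarrow> f v = y" if "y \<in> W" "v \<in> V" for y v
    using that w by (auto simp: g_def W_def)
  have gw: "g v = w \<longleftrightarrow> f v = a \<or> f v = b" if "v \<in> V" for v
    using that w by (auto simp: g_def)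
  have old: "linked V s g x y \<longleftrightarrow> linked V s f x y" if "x \<in> W" "y \<in> W" for s x y
    unfolding linked_def using that by (simp add: gW cong: bex_cong)
  have new: "linked V s g w x \<longleftrightarrow> linked V s f a x \<or> linked V s f b x" if "x \<in> W" for s x
  proof -
    have "linked V s g w x \<longleftrightarrow> (\<exists>u\<in>V. \<exists>v\<in>V. (f u = a \<or> f u = b) \<and> f v = x \<and> s u v)"
      unfolding linked_def using that by (simp add: gW gw cong: bex_cong)
    then show ?thesis unfolding linked_def by blast
  qed
  have some: "linked V r f x y \<or> linked V (\<lambda>u v. \<not> r u v) f x y"
    if "x \<in> f ` V" "y \<in> f ` V" for x y
    using that unfolding linked_def by blast
  have key: "({x, y} \<in> black (contract ?Q a b w) \<longleftrightarrow> {x, y} \<in> black (quotient V r g)) \<and>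
      ({x, y} \<in> red (contract ?Q a b w) \<longleftrightarrow> {x, y} \<in> red (quotient V r g))"
    if x: "x \<in> insert w W" and y: "y \<in> W" and xy: "x \<noteq> y" for x y
  proof (cases "x = w")
    case True
    have "y \<in> tverts ?Q - {a, b}" "w \<notin> tverts ?Q" using y w by (simp_all add: W_def)
    note new' = contract_new[OF this]
    have "y \<in> f ` V" "a \<noteq> y" "b \<noteq> y" using y by (auto simp: W_def)
    then show ?thesis unfolding True new' using True xy y a b some[of a y] some[of b y]
      by (auto simp: black_quotient_iff[OF sym] red_quotient_iff[OF sym] mixed_def im new
            simp del: image_eqI)
  next
    case False
    then have xW: "x \<in> W" using x by simp
    have "x \<in> tverts ?Q - {a, b}" "y \<in> tverts ?Q - {a, b}" "w \<notin> tverts ?Q"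
      using xW y w by (simp_all add: W_def)
    note old' = contract_old[OF this]
    have "x \<in> f ` V" "y \<in> f ` V" using xW y by (auto simp: W_def)
    then show ?thesis unfolding old' using xW y xy
      by (simp add: black_quotient_iff[OF sym] red_quotient_iff[OF sym] mixed_def im old)
  qed
  have "contract ?Q a b w = quotient V r g"
  proof (rule trigraph_eqI)
    show "is_trigraph (contract ?Q a b w)" "is_trigraph (quotient V r g)"
      using V sym w by (simp_all add: is_trigraph_contract is_trigraph_quotient)
    show tv: "tverts (contract ?Q a b w) = tverts (quotient V r g)"
      by (simp add: contract_def Let_def im W_def)
    fix x y assume "x \<in> tverts (contract ?Q a b w)" "y \<in> tverts (contract ?Q a b w)" "x \<noteq> y"
    then have "x \<in> insert w W \<and> y \<in> W \<or> y \<in> insert w W \<and> x \<in> W"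
      unfolding tv tverts_quotient im by auto
    then show "({x, y} \<in> black (contract ?Q a b w) \<longleftrightarrow> {x, y} \<in> black (quotient V r g)) \<and>
      ({x, y} \<in> red (contract ?Q a b w) \<longleftrightarrow> {x, y} \<in> red (quotient V r g))"
      using key[of x y] key[of y x] \<open>x \<noteq> y\<close> by (auto simp: insert_commute)
  qed
  then show ?thesis unfolding g_def .
qed

section \<open>Reducible trigraphs\<close>

text \<open>
  Existence of a sequence of contractions to a single vertex, without the indices of a
  \<open>d\<close>-sequence, so that sequences can be built by induction from their far end.
\<close>

inductive reducible :: "nat \<Rightarrow> 'a trigraph \<Rightarrow> bool" for d where
  single: "is_trigraph T \<Longrightarrow> card (tverts T) = 1 \<Longrightarrow> red_degree T \<le> d \<Longrightarrow> reducible d T"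
| step: "is_trigraph T \<Longrightarrow> red_degree T \<le> d \<Longrightarrow> is_contraction T T' \<Longrightarrow> reducible d T' \<Longrightarrow>
    reducible d T"

lemma card_contraction:
  assumes "is_trigraph T" "is_contraction T T'"
  shows "card (tverts T) = Suc (card (tverts T'))"
proof -
  obtain u v w where "u \<in> tverts T" "v \<in> tverts T" "u \<noteq> v" "w \<notin> tverts T"
    and T': "T' = contract T u v w"
    using assms(2) unfolding is_contraction_def by blast
  moreover have "finite (tverts T)" using assms(1) by (simp add: is_trigraph_def)
  ultimately show ?thesis using card_tverts_contract[of T u v w] by simp
qed

lemma reducible_imp_sequence:
  assumes "reducible d T"
  shows "\<exists>S. S (card (tverts T)) = T \<and> (\<forall>i\<in>{1..<card (tverts T)}. is_contraction (S (i + 1)) (S i)) \<and>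
    (\<forall>i\<in>{1..card (tverts T)}. is_trigraph (S i) \<and> red_degree (S i) \<le> d)"
  using assms
proof induction
  case (single T)
  then show ?case by (intro exI[of _ "\<lambda>_. T"]) auto
next
  case (step T T')
  let ?n = "card (tverts T')"
  obtain S where S: "S ?n = T'" "\<forall>i\<in>{1..<?n}. is_contraction (S (i + 1)) (S i)"
    "\<forall>i\<in>{1..?n}. is_trigraph (S i) \<and> red_degree (S i) \<le> d"
    using step.IH by blast
  have "card (tverts T) = Suc ?n" using card_contraction step.hyps by blast
  then show ?case using S step.hyps
    by (intro exI[of _ "S(Suc ?n := T)"]) (auto simp: less_Suc_eq le_Suc_eq)
qed

lemma twin_width_le_if_reducible:
  assumes "reducible d (trigraph_of G)"
  shows "twin_width G \<le> d"
proof -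
  have "tverts (trigraph_of G) = verts G" by (simp add: trigraph_of_def)
  then obtain S where "d_sequence d G S"
    using reducible_imp_sequence[OF assms] unfolding d_sequence_def Let_def by auto
  then show ?thesis by (rule twin_width_le)
qed

lemma red_degree_le:
  assumes "finite (tverts T)" "tverts T \<noteq> {}"
    "\<And>v. v \<in> tverts T \<Longrightarrow> card {x \<in> tverts T. {v, x} \<in> red T} \<le> d"
  shows "red_degree T \<le> d"
  unfolding red_degree_def using assms by (subst Max_le_iff) auto

text \<open>
  On \<open>d + 1\<close> vertices no red degree can exceed \<open>d\<close>, so any contractions will do.
\<close>

lemma reducible_if_small:
  fixes T :: "'a::infinite trigraph"
  assumes "is_trigraph T" "tverts T \<noteq> {}" "card (tverts T) \<le> Suc d"
  shows "reducible d T"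
  using assms
proof (induction "card (tverts T)" arbitrary: T rule: less_induct)
  case less
  have fin: "finite (tverts T)" using less.prems by (simp add: is_trigraph_def)
  have deg: "red_degree T \<le> d"
  proof (rule red_degree_le[OF fin less.prems(2)])
    fix v assume v: "v \<in> tverts T"
    have "{v, v} \<notin> red T"
      using less.prems(1) by (fastforce simp: is_trigraph_def)
    then have "{x \<in> tverts T. {v, x} \<in> red T} \<subseteq> tverts T - {v}" by auto
    then have "card {x \<in> tverts T. {v, x} \<in> red T} \<le> card (tverts T - {v})"
      using fin by (intro card_mono) auto
    also have "\<dots> \<le> d" using less.prems(3) v fin by simp
    finally show "card {x \<in> tverts T. {v, x} \<in> red T} \<le> d" .
  qed
  show ?case
  proof (cases "card (tverts T) = 1")
    case True
    then show ?thesis using reducible.single[OF less.prems(1)] deg by blast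
  next
    case False
    obtain u where u: "u \<in> tverts T" using less.prems(2) by blast
    have "tverts T \<noteq> {u}" using False by auto
    then obtain v where v: "v \<in> tverts T" "u \<noteq> v" using u by blast
    obtain w where w: "w \<notin> tverts T" using fin ex_new_if_finite infinite_UNIV by blast
    let ?T = "contract T u v w"
    have "Suc (card (tverts ?T)) = card (tverts T)"
      by (rule card_tverts_contract[OF fin u v w])
    moreover have "tverts ?T \<noteq> {}" by (simp add: contract_def Let_def)
    ultimately have "reducible d ?T"
      using less.prems w by (intro less.hyps is_trigraph_contract) auto
    moreover have "is_contraction T ?T" using u v w by (auto simp: is_contraction_def)
    ultimately show ?thesis using reducible.step[OF less.prems(1) deg] by blast
  qed
qed

section \<open>Graphs with renamed vertices\<close>

text \<open>
  Vertices are best described by a datatype of their own, while contraction needs an infinite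
  supply of names; the injection \<open>e\<close> embeds the former into the latter.
\<close>

definition graph_on :: "'v set \<Rightarrow> ('v \<Rightarrow> 'v \<Rightarrow> bool) \<Rightarrow> ('v \<Rightarrow> 'a) \<Rightarrow> 'a graph" where
  "graph_on V r e = \<lparr>verts = e ` V, edges = {{e u, e v} | u v. u \<in> V \<and> v \<in> V \<and> r u v}\<rparr>"

lemma edge_graph_on_iff:
  assumes "symp r" "inj_on e V" "u \<in> V" "v \<in> V"
  shows "{e u, e v} \<in> edges (graph_on V r e) \<longleftrightarrow> r u v"
proof
  assume "{e u, e v} \<in> edges (graph_on V r e)"
  then obtain x y where xy: "{e u, e v} = {e x, e y}" "x \<in> V" "y \<in> V" "r x y"
    by (auto simp: graph_on_def)
  then have "u = x \<and> v = y \<or> u = y \<and> v = x"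
    using assms(2-4) by (auto simp: doubleton_eq_iff inj_on_eq_iff)
  then show "r u v" using xy(4) sympD[OF assms(1) xy(4)] by blast
qed (use assms in \<open>auto simp: graph_on_def\<close>)

lemma nbhd_graph_on:
  assumes "symp r" "inj_on e V" "u \<in> V"
  shows "nbhd (graph_on V r e) (e u) = e ` {v \<in> V. r u v}"
proof -
  have "verts (graph_on V r e) = e ` V" by (simp add: graph_on_def)
  then show ?thesis using edge_graph_on_iff[OF assms] by (auto simp: nbhd_def)
qed

lemma simple_graph_on:
  assumes "finite V" "inj_on e V" "irreflp r"
  shows "simple_graph (graph_on V r e)"
  unfolding simple_graph_def
proof (intro conjI ballI)
  show "finite (verts (graph_on V r e))" using assms by (simp add: graph_on_def)
  fix x assume "x \<in> edges (graph_on V r e)"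
  then obtain u v where uv: "x = {e u, e v}" "u \<in> V" "v \<in> V" "r u v"
    by (auto simp: graph_on_def)
  then have "u \<noteq> v" using assms(3) by (auto simp: irreflp_def)
  then have "e u \<noteq> e v" using uv assms(2) by (simp add: inj_on_eq_iff)
  then show "x \<subseteq> verts (graph_on V r e)" "card x = 2" using uv by (auto simp: graph_on_def)
qed

text \<open>
  Under an injective labelling all classes are singletons, which cannot be mixed: the
  contraction sequence starts with a quotient.
\<close>

lemma trigraph_of_graph_on:
  assumes "finite V" "symp r" "irreflp r" "inj_on e V"
  shows "trigraph_of (graph_on V r e) = quotient V r e"
proof (rule trigraph_eqI)
  show "is_trigraph (trigraph_of (graph_on V r e))" "is_trigraph (quotient V r e)"
    using assms by (simp_all add: is_trigraph_quotient is_trigraph_trigraph_of simple_graph_on)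
  show tv: "tverts (trigraph_of (graph_on V r e)) = tverts (quotient V r e)"
    by (simp add: trigraph_of_def graph_on_def)
  fix x y assume "x \<in> tverts (trigraph_of (graph_on V r e))"
    "y \<in> tverts (trigraph_of (graph_on V r e))" "x \<noteq> y"
  then obtain u v where uv: "x = e u" "y = e v" "u \<in> V" "v \<in> V" unfolding tv by auto
  have "linked V s e x y \<longleftrightarrow> s u v" for s
    unfolding linked_def using uv assms(4) by (auto simp: inj_on_eq_iff)
  then show "({x, y} \<in> black (trigraph_of (graph_on V r e)) \<longleftrightarrow> {x, y} \<in> black (quotient V r e)) \<and>
      ({x, y} \<in> red (trigraph_of (graph_on V r e)) \<longleftrightarrow> {x, y} \<in> red (quotient V r e))"
    using \<open>x \<noteq> y\<close> uv edge_graph_on_iff[OF assms(2,4) uv(3,4)]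
    by (simp add: black_quotient_iff[OF assms(2)] red_quotient_iff[OF assms(2)] mixed_def
          trigraph_of_def)
qed

section \<open>Contracting vertices into bags\<close>

text \<open>
  The partition in which the vertices of \<open>D\<close> have been put into their bags and all other
  vertices are still singletons.
\<close>

definition bag_label :: "('v \<Rightarrow> 'b) \<Rightarrow> 'v set \<Rightarrow> 'v \<Rightarrow> 'b + 'v" where
  "bag_label \<beta> D v = (if v \<in> D then Inl (\<beta> v) else Inr v)"

text \<open>
  Renaming labels injectively keeps the red degree, so it may be computed with the labels \<open>h\<close>
  while the trigraph itself uses the names \<open>g \<circ> h\<close>.
\<close>

lemma red_degree_quotient_le:
  assumes "finite V" "V \<noteq> {}" "symp r" and g: "inj_on g (h ` V)"
    and deg: "\<And>u. u \<in> V \<Longrightarrow> card {c \<in> h ` V. c \<noteq> h u \<and> mixed V r h (h u) c} \<le> d"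
  shows "red_degree (quotient V r (g \<circ> h)) \<le> d"
proof (rule red_degree_le)
  show "finite (tverts (quotient V r (g \<circ> h)))" "tverts (quotient V r (g \<circ> h)) \<noteq> {}"
    using assms by auto
next
  fix a assume "a \<in> tverts (quotient V r (g \<circ> h))"
  then obtain u where u: "u \<in> V" "a = g (h u)" by auto
  let ?R = "{c \<in> h ` V. c \<noteq> h u \<and> mixed V r h (h u) c}"
  have link: "linked V s (g \<circ> h) (g (h u)) (g (h v)) \<longleftrightarrow> linked V s h (h u) (h v)"
    if "v \<in> V" for s v
    unfolding linked_def using u that g by (auto simp: inj_on_eq_iff)
  have "{x \<in> tverts (quotient V r (g \<circ> h)). {a, x} \<in> red (quotient V r (g \<circ> h))} \<subseteq> g ` ?R"
    using u(2) assms(3) link by (auto simp: red_quotient_iff mixed_def)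
  then have "card {x \<in> tverts (quotient V r (g \<circ> h)). {a, x} \<in> red (quotient V r (g \<circ> h))}
      \<le> card (g ` ?R)"
    using assms(1) by (intro card_mono) auto
  also have "\<dots> \<le> card ?R" using assms(1) by (intro card_image_le) auto
  also have "\<dots> \<le> d" by (rule deg[OF u(1)])
  finally show "card {x \<in> tverts (quotient V r (g \<circ> h)). {a, x} \<in> red (quotient V r (g \<circ> h))} \<le> d" .
qed

lemma inj_on_update_insert:
  assumes "inj_on g A" "z \<notin> g ` A"
  shows "inj_on (g(c := z)) (insert c A)"
  unfolding inj_on_def using assms by (auto simp: inj_on_eq_iff)

text \<open>
  Vertices enter their bags \<open>\<beta>\<close> one by one in the order of the rank \<open>\<sigma>\<close>, with ties broken
  arbitrarily; the sets \<open>D\<close> that arise are those in which no rank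
  exceeds the rank of a remaining vertex. Hence it is enough to bound the red degree of
  the partitions given by such sets. The names \<open>g\<close> are arbitrary because a contraction introduces
  a name that is not known beforehand.
\<close>

lemma reducible_by_bagging:
  fixes V :: "'v set" and \<beta> :: "'v \<Rightarrow> 'b" and \<sigma> :: "'v \<Rightarrow> nat"
    and g :: "'b + 'v \<Rightarrow> 'a::infinite"
  assumes V: "finite V" "V \<noteq> {}" and sym: "symp r" and bags: "card (\<beta> ` V) \<le> Suc d"
    and deg: "\<And>D u. D \<subseteq> V \<Longrightarrow> \<forall>x\<in>D. \<forall>y\<in>V - D. \<sigma> x \<le> \<sigma> y \<Longrightarrow> u \<in> V \<Longrightarrow>
      card {c \<in> bag_label \<beta> D ` V. c \<noteq> bag_label \<beta> D u \<and>
        mixed V r (bag_label \<beta> D) (bag_label \<beta> D u) c} \<le> d"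
    and D: "D \<subseteq> V" "\<forall>x\<in>D. \<forall>y\<in>V - D. \<sigma> x \<le> \<sigma> y"
    and g: "inj_on g (bag_label \<beta> D ` V)"
  shows "reducible d (quotient V r (g \<circ> bag_label \<beta> D))"
  using D g
proof (induction "card (V - D)" arbitrary: D g)
  case 0
  \<comment> \<open>Only the bags are left, at most \<open>d + 1\<close> of them.\<close>
  then have "D = V" using V(1) by (metis Diff_eq_empty_iff card_0_eq finite_Diff subset_antisym)
  then have "(g \<circ> bag_label \<beta> D) ` V = (g \<circ> Inl) ` \<beta> ` V"
    by (auto simp: bag_label_def image_iff)
  then have "card ((g \<circ> bag_label \<beta> D) ` V) \<le> card (\<beta> ` V)"
    using V by (simp add: card_image_le)
  then show ?case
    using V sym bags by (intro reducible_if_small is_trigraph_quotient) auto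
next
  case (Suc n)
  let ?h = "bag_label \<beta> D"
  have "V - D \<noteq> {}" using Suc.hyps(2) by force
  then obtain v where v: "v \<in> V - D" and min: "\<And>y. y \<in> V - D \<Longrightarrow> \<sigma> v \<le> \<sigma> y"
    using ex_has_least_nat[of "\<lambda>y. y \<in> V - D" _ \<sigma>] by (metis equals0I)
  let ?D = "insert v D"
  let ?h' = "bag_label \<beta> ?D"
  have n: "n = card (V - ?D)"
    using Suc.hyps(2) v V by (simp add: Diff_insert[of V v D])
  have D': "?D \<subseteq> V" "\<forall>x\<in>?D. \<forall>y\<in>V - ?D. \<sigma> x \<le> \<sigma> y"
    using Suc.prems v min by auto
  have tri: "is_trigraph (quotient V r (g \<circ> ?h))"
    using V sym by (intro is_trigraph_quotient)
  have red: "red_degree (quotient V r (g \<circ> ?h)) \<le> d"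
    using V sym Suc.prems by (intro red_degree_quotient_le deg) auto
  have hv: "?h v = Inr v" "Inr v \<in> ?h ` V" using v by (auto simp: bag_label_def image_iff)
  have h': "?h' u = (if u = v then Inl (\<beta> v) else ?h u)" for u
    by (auto simp: bag_label_def)
  have Inr_eq: "?h u = Inr v \<longleftrightarrow> u = v" for u using v by (auto simp: bag_label_def)
  have im': "?h' ` V \<subseteq> insert (Inl (\<beta> v)) (?h ` V - {Inr v})"
    using Inr_eq by (auto simp: h')
  show ?case
  proof (cases "Inl (\<beta> v) \<in> ?h ` V")
    case False
    \<comment> \<open>The bag of \<open>v\<close> is still empty: the partition does not change, and the bag inherits the
      name of \<open>v\<close>.\<close>
    let ?g = "g(Inl (\<beta> v) := g (Inr v))"
    have "inj_on ?g (insert (Inl (\<beta> v)) (?h ` V - {Inr v}))"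
    proof (rule inj_on_update_insert)
      show "inj_on g (?h ` V - {Inr v})" using Suc.prems(3) by (rule inj_on_subset) blast
      show "g (Inr v) \<notin> g ` (?h ` V - {Inr v})"
        using inj_on_image_mem_iff[OF Suc.prems(3) hv(2), of "?h ` V - {Inr v}"] by simp
    qed
    then have "inj_on ?g (?h' ` V)" using im' by (rule inj_on_subset)
    then have "reducible d (quotient V r (?g \<circ> ?h'))" using n D' by (intro Suc.hyps)
    moreover have "quotient V r (?g \<circ> ?h') = quotient V r (g \<circ> ?h)"
    proof (rule quotient_cong)
      fix u assume "u \<in> V"
      then have "?h u \<noteq> Inl (\<beta> v)" using False by (metis imageI)
      then show "(?g \<circ> ?h') u = (g \<circ> ?h) u" using hv(1) by (simp add: h')
    qed
    ultimately show ?thesis by simp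
  next
    case True
    \<comment> \<open>Contracting \<open>v\<close> with its bag gives the bag a fresh name.\<close>
    obtain w where w: "w \<notin> (g \<circ> ?h) ` V"
      using V by (meson ex_new_if_finite finite_imageI infinite_UNIV)
    let ?g = "g(Inl (\<beta> v) := w)"
    let ?a = "g (Inr v)" and ?b = "g (Inl (\<beta> v))"
    have ab: "?a \<in> (g \<circ> ?h) ` V" "?b \<in> (g \<circ> ?h) ` V"
      using imageI[OF hv(2), of g] imageI[OF True, of g] by (simp_all only: image_comp)
    have "?a \<noteq> ?b" using inj_on_eq_iff[OF Suc.prems(3) hv(2) True] by simp
    then have "is_contraction (quotient V r (g \<circ> ?h)) (contract (quotient V r (g \<circ> ?h)) ?a ?b w)"
      using ab w unfolding is_contraction_def tverts_quotient by blast
    moreover have "contract (quotient V r (g \<circ> ?h)) ?a ?b w = quotient V r (?g \<circ> ?h')"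
    proof -
      have "contract (quotient V r (g \<circ> ?h)) ?a ?b w =
          quotient V r (\<lambda>u. if (g \<circ> ?h) u \<in> {?a, ?b} then w else (g \<circ> ?h) u)"
        by (rule contract_quotient[OF V(1) sym ab \<open>?a \<noteq> ?b\<close> w])
      also have "\<dots> = quotient V r (?g \<circ> ?h')"
      proof (rule quotient_cong)
        fix u assume "u \<in> V"
        then have "g (?h u) = ?a \<longleftrightarrow> ?h u = Inr v" "g (?h u) = ?b \<longleftrightarrow> ?h u = Inl (\<beta> v)"
          using inj_on_eq_iff[OF Suc.prems(3) imageI hv(2)] inj_on_eq_iff[OF Suc.prems(3) imageI True]
          by simp_all
        then show "(if (g \<circ> ?h) u \<in> {?a, ?b} then w else (g \<circ> ?h) u) = (?g \<circ> ?h') u"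
          by (auto simp: h' Inr_eq)
      qed
      finally show ?thesis .
    qed
    moreover have "inj_on ?g (insert (Inl (\<beta> v)) (?h ` V - {Inr v}))"
    proof (rule inj_on_update_insert)
      show "inj_on g (?h ` V - {Inr v})" using Suc.prems(3) by (rule inj_on_subset) blast
      show "w \<notin> g ` (?h ` V - {Inr v})" using w by (auto simp: image_comp)
    qed
    then have "inj_on ?g (?h' ` V)" using im' by (rule inj_on_subset)
    then have "reducible d (quotient V r (?g \<circ> ?h'))" using n D' by (intro Suc.hyps)
    ultimately show ?thesis using reducible.step[OF tri red] by metis
  qed
qed

section \<open>The row-column graph\<close>

datatype vertex = Base nat | Marker nat | Row nat nat "nat set"

fun row_joins :: "vertex \<Rightarrow> vertex \<Rightarrow> bool" where
  "row_joins (Row i j S) (Base x) \<longleftrightarrow> x \<le> i \<or> x \<in> S"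
| "row_joins (Row i j S) (Marker l) \<longleftrightarrow> l = j"
| "row_joins _ _ \<longleftrightarrow> False"

definition adj :: "vertex \<Rightarrow> vertex \<Rightarrow> bool" where
  "adj u v \<longleftrightarrow> row_joins u v \<or> row_joins v u"

definition columns :: "nat \<Rightarrow> nat \<Rightarrow> vertex set" where
  "columns m d = Base ` {..<m} \<union> Marker ` {..<d}"

text \<open>
  The window leaves out \<open>i + 1\<close>, which makes \<open>i\<close> readable from the neighbourhood. It has
  \<open>d - 2\<close> elements and is empty for \<open>d \<le> 2\<close>; for \<open>d = 1\<close> the rows form a half graph with the
  base columns.
\<close>

definition rows :: "nat \<Rightarrow> nat \<Rightarrow> vertex set" where
  "rows m d = {Row i j S | i j S. i < m - d \<and> j < d \<and> S \<subseteq> {i + 2..<i + d}}"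

fun bag :: "vertex \<Rightarrow> nat" where
  "bag (Row i j S) = Suc j"
| "bag _ = 0"

text \<open>
  The sweep from left to right. \<open>Base i\<close> precedes the rows at \<open>i\<close>, which are joined to it, so
  that these rows are never red to the column bag before they are swept. Rows have positions below
  \<open>m\<close>, so \<open>2 * m\<close> places the markers after all of them.
\<close>

fun rank :: "nat \<Rightarrow> vertex \<Rightarrow> nat" where
  "rank m (Base i) = 2 * i"
| "rank m (Row i j S) = 2 * i + 1"
| "rank m (Marker j) = 2 * m"

lemma symp_adj: "symp adj"
  by (auto simp: symp_def adj_def)

lemma finite_columns: "finite (columns m d)"
  by (simp add: columns_def)

lemma finite_rows: "finite (rows m d)"
proof -
  have "rows m d \<subseteq> (\<lambda>(i, j, S). Row i j S) ` ({..<m} \<times> {..<d} \<times> Pow {..<m})"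
  proof
    fix v assume "v \<in> rows m d"
    then obtain i j S where v: "v = Row i j S" "i < m - d" "j < d" "S \<subseteq> {i + 2..<i + d}"
      by (auto simp: rows_def)
    then have "S \<subseteq> {..<m}" by fastforce
    then show "v \<in> (\<lambda>(i, j, S). Row i j S) ` ({..<m} \<times> {..<d} \<times> Pow {..<m})"
      using v by (intro image_eqI[of _ _ "(i, j, S)"]) auto
  qed
  then show ?thesis by (rule finite_subset) simp
qed

lemma columns_rows_disjoint: "columns m d \<inter> rows m d = {}"
  by (auto simp: columns_def rows_def)

lemma adj_row_imp: "u \<in> rows m d \<Longrightarrow> v \<in> columns m d \<union> rows m d \<Longrightarrow> adj u v \<Longrightarrow> v \<in> columns m d"
  by (auto simp: adj_def rows_def columns_def)

lemma adj_column_imp: "u \<in> columns m d \<Longrightarrow> v \<in> columns m d \<union> rows m d \<Longrightarrow> adj u v \<Longrightarrow> v \<in> rows m d"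
  by (auto simp: adj_def rows_def columns_def)

lemma bag_eq_0_iff: "u \<in> columns m d \<union> rows m d \<Longrightarrow> bag u = 0 \<longleftrightarrow> u \<in> columns m d"
  by (cases u) (auto simp: columns_def rows_def)

lemma bag_row: "u \<in> rows m d \<Longrightarrow> bag u \<in> Suc ` {..<d}"
  by (auto simp: rows_def)

text \<open>
  The neighbours in question are counted by the labels they can have. Two single vertices are
  never red to each other, which leaves at most one label for a row, the \<open>d\<close> row bags for a column
  or the column bag, and for a row bag the column bag together with \<open>d - 1\<close> base columns.
\<close>

lemma bagging_degree:
  fixes m d :: nat
  defines "V \<equiv> columns m d \<union> rows m d"
  assumes D: "D \<subseteq> V" and closed: "\<forall>x\<in>D. \<forall>y\<in>V - D. rank m x \<le> rank m y" and u: "u \<in> V"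
  shows "card {c \<in> bag_label bag D ` V. c \<noteq> bag_label bag D u \<and>
    mixed V adj (bag_label bag D) (bag_label bag D u) c} \<le> d"
    (is "card ?N \<le> d")
proof -
  let ?h = "bag_label bag D"
  have witnesses: "\<exists>u1\<in>V. \<exists>v1\<in>V. \<exists>u2\<in>V. \<exists>v2\<in>V. ?h u1 = ?h u \<and> ?h v1 = c \<and> adj u1 v1 \<and>
      ?h u2 = ?h u \<and> ?h v2 = c \<and> \<not> adj u2 v2" if "c \<in> ?N" for c
    using that unfolding mixed_def linked_def by blast
  have outside: "x \<notin> D \<Longrightarrow> ?h y = ?h x \<Longrightarrow> y = x" for x y
    by (auto simp: bag_label_def split: if_splits)
  have inside: "x \<in> D \<Longrightarrow> ?h y = ?h x \<Longrightarrow> y \<in> D \<and> bag y = bag x" for x y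
    by (auto simp: bag_label_def split: if_splits)
  have label: "x \<in> D \<Longrightarrow> ?h x = Inl (bag x)" for x by (simp add: bag_label_def)
  have bound: ?thesis if "?N \<subseteq> L" "finite L" "card L \<le> d" for L
    using card_mono[OF that(2,1)] that(3) by simp
  let ?rowbags = "(Inl ` Suc ` {..<d}) :: (nat + vertex) set"
  have rowbags: "finite ?rowbags" "card ?rowbags \<le> d"
    by (simp_all add: card_image)
  consider "u \<in> rows m d" "u \<notin> D" | "u \<in> columns m d" "u \<notin> D" | "u \<in> columns m d" "u \<in> D"
    | "u \<in> rows m d" "u \<in> D"
    using u by (auto simp: V_def)
  then show ?thesis
  proof cases
    case 1
    \<comment> \<open>A single row: only the column bag.\<close>
    have "?N \<subseteq> {Inl 0}"
    proof
      fix c assume "c \<in> ?N"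
      then obtain u1 v1 u2 v2 where w: "v1 \<in> V" "?h u1 = ?h u" "?h v1 = c" "adj u1 v1"
        "?h u2 = ?h u" "?h v2 = c" "\<not> adj u2 v2" using witnesses by blast
      have "u1 = u" "u2 = u" using outside 1 w by metis+
      then have "v1 \<noteq> v2" using w by metis
      then have "v1 \<in> D" using outside w by metis
      moreover have "v1 \<in> columns m d"
        using adj_row_imp[OF 1(1)] w \<open>u1 = u\<close> by (simp add: V_def)
      ultimately have "c = Inl (bag v1)" "bag v1 = 0"
        using w(3) label bag_eq_0_iff[of v1 m d] by auto
      then show "c \<in> {Inl 0}" by simp
    qed
    moreover have "card {Inl 0 :: nat + vertex} \<le> d" using 1 by (auto simp: rows_def)
    ultimately show ?thesis by (intro bound[of "{Inl 0}"]) auto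
  next
    case 2
    \<comment> \<open>A single column: only row bags.\<close>
    have "?N \<subseteq> ?rowbags"
    proof
      fix c assume "c \<in> ?N"
      then obtain u1 v1 u2 v2 where w: "v1 \<in> V" "?h u1 = ?h u" "?h v1 = c" "adj u1 v1"
        "?h u2 = ?h u" "?h v2 = c" "\<not> adj u2 v2" using witnesses by blast
      have "u1 = u" "u2 = u" using outside 2 w by metis+
      then have "v1 \<noteq> v2" using w by metis
      then have "v1 \<in> D" using outside w by metis
      moreover have "v1 \<in> rows m d"
        using adj_column_imp[OF 2(1)] w \<open>u1 = u\<close> by (simp add: V_def)
      ultimately show "c \<in> ?rowbags" using w(3) label[of v1] bag_row[of v1 m d] by auto
    qed
    then show ?thesis using rowbags by (rule bound)
  next
    case 3
    \<comment> \<open>The column bag: only row bags, as a row that is still single is joined to all of it.\<close>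
    have "?N \<subseteq> ?rowbags"
    proof
      fix c assume "c \<in> ?N"
      then obtain u1 v1 u2 v2 where w: "u1 \<in> V" "v1 \<in> V" "u2 \<in> V" "?h u1 = ?h u" "?h v1 = c"
        "adj u1 v1" "?h u2 = ?h u" "?h v2 = c" "\<not> adj u2 v2" using witnesses by blast
      have "bag u = 0" using bag_eq_0_iff[of u m d] 3 by simp
      then have u12: "u1 \<in> columns m d" "u2 \<in> D" "u2 \<in> columns m d"
        using inside[OF 3(2)] w bag_eq_0_iff unfolding V_def by metis+
      have v1: "v1 \<in> rows m d" using adj_column_imp[OF u12(1)] w by (simp add: V_def)
      have "v1 \<in> D"
      proof (rule ccontr)
        assume "v1 \<notin> D"
        then have "v2 = v1" using outside[of v1 v2] w(5,8) by simp
        obtain i j S where v1_eq: "v1 = Row i j S" "i < m - d" using v1 by (auto simp: rows_def)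
        \<comment> \<open>A swept column has at most the rank of the waiting row, so it is no marker.\<close>
        have "rank m u2 \<le> rank m v1"
          using closed u12(2) w(2) \<open>v1 \<notin> D\<close> by blast
        then have "\<exists>x. u2 = Base x \<and> x \<le> i"
          using u12(3) v1_eq by (auto simp: columns_def)
        then have "adj u2 v1" unfolding v1_eq adj_def by auto
        then show False using w \<open>v2 = v1\<close> by simp
      qed
      then show "c \<in> ?rowbags" using w(5) label[of v1] bag_row[OF v1] by auto
    qed
    then show ?thesis using rowbags by (rule bound)
  next
    case 4
    obtain i j S where u_eq: "u = Row i j S" "j < d" using 4 by (auto simp: rows_def)
    \<comment> \<open>A row bag: the column bag, and single base columns in a stretch of length \<open>d - 1\<close> that
      starts at the first one still single. Only base columns below \<open>m\<close> are vertices, so some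
      \<open>Base x\<close> lies outside \<open>D\<close> in any case.\<close>
    define i0 where "i0 = (LEAST x. Base x \<notin> D)"
    let ?L = "insert (Inl 0) ((Inr \<circ> Base) ` {i0..<i0 + (d - 1)}) :: (nat + vertex) set"
    have "?N \<subseteq> ?L"
    proof
      fix c assume "c \<in> ?N"
      then obtain u1 v1 u2 v2 where w: "u1 \<in> V" "v1 \<in> V" "u2 \<in> V" "?h u1 = ?h u" "?h v1 = c"
        "adj u1 v1" "?h u2 = ?h u" "?h v2 = c" "\<not> adj u2 v2" using witnesses by blast
      have bags: "u1 \<in> D" "bag u1 = Suc j" "bag u2 = Suc j"
        using inside[OF 4(2)] w u_eq by auto
      have u12: "u1 \<in> rows m d" "u2 \<in> rows m d"
        using bags w bag_eq_0_iff[of u1 m d] bag_eq_0_iff[of u2 m d] by (auto simp: V_def)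
      have v1: "v1 \<in> columns m d" using adj_row_imp[OF u12(1)] w by (simp add: V_def)
      obtain i1 S1 where u1_eq: "u1 = Row i1 j S1" "S1 \<subseteq> {i1 + 2..<i1 + d}"
        using u12(1) bags by (auto simp: rows_def)
      obtain i2 S2 where u2_eq: "u2 = Row i2 j S2"
        using u12(2) bags by (auto simp: rows_def)
      show "c \<in> ?L"
      proof (cases "v1 \<in> D")
        case True
        then have "c = Inl (bag v1)" "bag v1 = 0"
          using w(5) label v1 bag_eq_0_iff[of v1 m d] by auto
        then show ?thesis by simp
      next
        case False
        then have "v2 = v1" using outside[of v1 v2] w(5,8) by simp
        consider (marker) l where "v1 = Marker l" | (base) x where "v1 = Base x" "x < m"
          using v1 by (auto simp: columns_def)
        then show ?thesis
        proof cases
          case marker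
          \<comment> \<open>All rows of the bag agree on every marker.\<close>
          have "l = j" using w(6) unfolding u1_eq marker adj_def by simp
          then have "adj u2 v1" unfolding u2_eq marker adj_def by simp
          then show ?thesis using w \<open>v2 = v1\<close> by simp
        next
          case base
          have "Base x \<notin> D" using False base by simp
          then have i0: "Base i0 \<notin> D" "i0 \<le> x"
            unfolding i0_def by (rule LeastI, rule Least_le)
          have "Base i0 \<in> V" using i0 base by (auto simp: V_def columns_def)
          then have "rank m u1 \<le> rank m (Base i0)" using closed bags(1) i0(1) by blast
          then have "i1 < i0" unfolding u1_eq by simp
          moreover have "x \<le> i1 \<or> x \<in> S1" using w(6) unfolding u1_eq base adj_def by simp
          then have "x \<in> S1" using calculation i0(2) by simp
          then have "x < i1 + d" using u1_eq(2) by auto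
          ultimately have "x < i0 + (d - 1)" by linarith
          moreover have "c = Inr (Base x)" using w(5) False base by (simp add: bag_label_def)
          ultimately show ?thesis using i0(2) by auto
        qed
      qed
    qed
    moreover have "card ?L \<le> Suc (card ((Inr \<circ> Base) ` {i0..<i0 + (d - 1)} :: (nat + vertex) set))"
      by (simp add: card_insert_if)
    moreover have "card ((Inr \<circ> Base) ` {i0..<i0 + (d - 1)} :: (nat + vertex) set) \<le> d - 1"
      using card_image_le[of "{i0..<i0 + (d - 1)}"] by simp
    ultimately show ?thesis using u_eq(2) by (intro bound[of ?L]) auto
  qed
qed

lemma irreflp_adj: "irreflp adj"
proof (rule irreflpI)
  show "\<not> adj u u" for u by (cases u) (simp_all add: adj_def)
qed

lemma card_columns: "card (columns m d) = m + d"
proof -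
  have "card (columns m d) = card (Base ` {..<m}) + card (Marker ` {..<d})"
    unfolding columns_def by (rule card_Un_disjoint) auto
  also have "\<dots> = m + d" by (simp add: card_image inj_on_def)
  finally show ?thesis .
qed

text \<open>
  The bags are the column bag \<open>0\<close> and the row bags \<open>1, \<dots>, d\<close>.
\<close>

lemma twin_width_rows_columns:
  fixes e :: "vertex \<Rightarrow> 'a::infinite" and m d :: nat
  defines "V \<equiv> columns m d \<union> rows m d"
  assumes e: "inj_on e V" and "V \<noteq> {}"
  shows "twin_width (graph_on V adj e) \<le> d"
proof -
  let ?g = "case_sum (\<lambda>_. undefined) e"
  have fin: "finite V" by (simp add: V_def finite_columns finite_rows)
  have g: "?g \<circ> bag_label bag {} = e" by (auto simp: bag_label_def)
  have "bag ` V \<subseteq> {..d}" by (auto simp: V_def columns_def rows_def)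
  then have "card (bag ` V) \<le> Suc d" using card_mono[of "{..d}" "bag ` V"] by simp
  moreover have "inj_on ?g (bag_label bag {} ` V)"
    using e by (auto simp: inj_on_def bag_label_def)
  ultimately have "reducible d (quotient V adj (?g \<circ> bag_label bag {}))"
    using fin assms(3) symp_adj bagging_degree
    by (intro reducible_by_bagging[where \<sigma> = "rank m"]) (auto simp: V_def)
  then show ?thesis
    unfolding g trigraph_of_graph_on[OF fin symp_adj irreflp_adj e, symmetric]
    by (rule twin_width_le_if_reducible)
qed

lemma bipartite_rows_columns:
  fixes e :: "vertex \<Rightarrow> 'a" and m d :: nat
  defines "V \<equiv> columns m d \<union> rows m d"
  assumes e: "inj_on e V"
  shows "bipartite (graph_on V adj e)"
  unfolding bipartite_def
proof (intro exI conjI ballI)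
  show "e ` columns m d \<union> e ` rows m d = verts (graph_on V adj e)"
    by (auto simp: graph_on_def V_def)
  have "e ` columns m d \<inter> e ` rows m d = e ` (columns m d \<inter> rows m d)"
    using e by (intro inj_on_image_Int[symmetric]) (auto simp: V_def)
  then show "e ` columns m d \<inter> e ` rows m d = {}" by (simp add: columns_rows_disjoint)
  fix x assume "x \<in> edges (graph_on V adj e)"
  then obtain u v where uv: "x = {e u, e v}" "u \<in> V" "v \<in> V" "adj u v"
    by (auto simp: graph_on_def)
  then have "u \<in> columns m d \<and> v \<in> rows m d \<or> u \<in> rows m d \<and> v \<in> columns m d"
    using adj_row_imp[of u m d v] adj_column_imp[of u m d v] by (auto simp: V_def)
  then show "\<exists>a\<in>e ` columns m d. \<exists>b\<in>e ` rows m d. x = {a, b}"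
    unfolding uv(1) by (auto simp: insert_commute)
qed

section \<open>Counting the traces of rows\<close>

text \<open>
  The trace of a row on the columns determines the marker index \<open>j\<close>, then \<open>i\<close> through the gap
  at \<open>i + 1\<close>, and then \<open>S\<close>.
\<close>

lemma inj_on_row_traces:
  "inj_on (\<lambda>(i, j, S). {v \<in> columns m d. adj (Row i j S) v})
    (SIGMA i:{..<m - d}. {..<d} \<times> Pow {i + 2..<i + d})"
proof (rule inj_onI)
  fix p q :: "nat \<times> nat \<times> nat set"
  assume p: "p \<in> (SIGMA i:{..<m - d}. {..<d} \<times> Pow {i + 2..<i + d})"
    and q: "q \<in> (SIGMA i:{..<m - d}. {..<d} \<times> Pow {i + 2..<i + d})"
    and eq: "(case p of (i, j, S) \<Rightarrow> {v \<in> columns m d. adj (Row i j S) v}) =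
      (case q of (i, j, S) \<Rightarrow> {v \<in> columns m d. adj (Row i j S) v})"
  obtain i j S where p_eq: "p = (i, j, S)" by (cases p)
  obtain i' j' S' where q_eq: "q = (i', j', S')" by (cases q)
  have S: "i < m - d" "j < d" "S \<subseteq> {i + 2..<i + d}" using p p_eq by auto
  have S': "i' < m - d" "j' < d" "S' \<subseteq> {i' + 2..<i' + d}" using q q_eq by auto
  have iff: "adj (Row i j S) v \<longleftrightarrow> adj (Row i' j' S') v" if "v \<in> columns m d" for v
    using eq that unfolding p_eq q_eq by auto
  have base: "x \<le> i \<or> x \<in> S \<longleftrightarrow> x \<le> i' \<or> x \<in> S'" if "x < m" for x
    using iff[of "Base x"] that by (simp add: columns_def adj_def)
  have "j = j'" using iff[of "Marker j"] S by (simp add: columns_def adj_def)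
  moreover have "i = i'"
  proof (rule antisym)
    have "i' + 1 \<notin> S'" "i' + 1 < m" using S' by auto
    then show "i \<le> i'" using base[of "i' + 1"] by auto
    have "i + 1 \<notin> S" "i + 1 < m" using S by auto
    then show "i' \<le> i" using base[of "i + 1"] by auto
  qed
  moreover have "S = S'"
  proof (rule set_eqI)
    fix x
    show "x \<in> S \<longleftrightarrow> x \<in> S'"
    proof (cases "i < x \<and> x < m")
      case True
      then show ?thesis using base[of x] \<open>i = i'\<close> by auto
    next
      case False
      then have "x \<notin> {i + 2..<i + d}" using S(1) by auto
      then show ?thesis using S(3) S'(3) \<open>i = i'\<close> by blast
    qed
  qed
  ultimately show "p = q" using p_eq q_eq by simp
qed

lemma card_row_indices:
  "card (SIGMA i:{..<m - d}. {..<d} \<times> Pow {i + 2..<i + d}) = (m - d) * (d * 2 ^ (d - 2))"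
  by (simp add: card_SigmaI card_cartesian_product card_Pow)

lemma card_nbhds_rows_columns:
  fixes e :: "vertex \<Rightarrow> 'a" and m d :: nat
  defines "V \<equiv> columns m d \<union> rows m d"
  assumes e: "inj_on e V"
  shows "(m - d) * (d * 2 ^ (d - 2)) \<le> card (nbhds_on (graph_on V adj e) (e ` columns m d))"
proof -
  let ?I = "SIGMA i:{..<m - d}. {..<d} \<times> Pow {i + 2..<i + d}"
  let ?t = "\<lambda>(i, j, S). {v \<in> columns m d. adj (Row i j S) v}"
  have fin: "finite V" by (simp add: V_def finite_columns finite_rows)
  have row: "nbhd (graph_on V adj e) (e u) \<inter> e ` columns m d = e ` {v \<in> columns m d. adj u v}"
    if "u \<in> V" for u
  proof -
    have "e ` {v \<in> V. adj u v} \<inter> e ` columns m d = e ` ({v \<in> V. adj u v} \<inter> columns m d)"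
      using e by (intro inj_on_image_Int[symmetric]) (auto simp: V_def)
    also have "{v \<in> V. adj u v} \<inter> columns m d = {v \<in> columns m d. adj u v}"
      by (auto simp: V_def)
    finally show ?thesis by (simp add: nbhd_graph_on[OF symp_adj e that])
  qed
  have verts: "verts (graph_on V adj e) = e ` V" by (simp add: graph_on_def)
  have "inj_on (image e) (Pow V)" using e by (rule inj_on_image_Pow)
  then have "inj_on (image e) (?t ` ?I)" by (rule inj_on_subset) (auto simp: V_def)
  then have "card (image e ` ?t ` ?I) = card ?I"
    using inj_on_row_traces by (simp add: card_image)
  moreover have "image e ` ?t ` ?I \<subseteq> nbhds_on (graph_on V adj e) (e ` columns m d)"
  proof
    fix N assume "N \<in> image e ` ?t ` ?I"
    then obtain i j S where N: "N = e ` {v \<in> columns m d. adj (Row i j S) v}"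
      and ijS: "(i, j, S) \<in> ?I" by auto
    from ijS have "Row i j S \<in> V" unfolding V_def rows_def by auto
    then show "N \<in> nbhds_on (graph_on V adj e) (e ` columns m d)"
      using row N verts unfolding nbhds_on_def by blast
  qed
  moreover have "finite (nbhds_on (graph_on V adj e) (e ` columns m d))"
    using fin verts by (simp add: nbhds_on_def)
  ultimately have "card ?I \<le> card (nbhds_on (graph_on V adj e) (e ` columns m d))"
    by (metis (no_types, lifting) card_mono)
  then show ?thesis by (simp only: card_row_indices)
qed

theorem proposition2:
  shows "\<exists>c::real. c > 0 \<and> (\<exists>C::real. \<forall>d::nat. \<exists>k0::nat. k0 \<ge> 1 \<and> (\<forall>k\<ge>k0.
    \<exists>(G :: nat graph) X.
      simple_graph G \<and> bipartite G \<and> twin_width G \<le> d \<and>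
      X \<subseteq> verts G \<and> card X = k \<and>
      real (card (nbhds_on G X)) \<ge> c * real d * 2 ^ d * real (card X) \<and>
      (d \<ge> 1 \<longrightarrow> (\<exists>\<theta>::real. \<bar>\<theta>\<bar> \<le> C \<and>
        c * real d * 2 ^ d * real (card X)
          = 2 powr (real d + log 2 (real d) + \<theta>) * real (card X)))))"
proof -
  have main: "\<exists>(G :: nat graph) X.
      simple_graph G \<and> bipartite G \<and> twin_width G \<le> d \<and>
      X \<subseteq> verts G \<and> card X = k \<and>
      real (card (nbhds_on G X)) \<ge> 1 / 8 * real d * 2 ^ d * real (card X)"
    if k: "k \<ge> 4 * d + 1" for d k :: nat
  proof -
    define m where "m = k - d"
    define V where "V = columns m d \<union> rows m d"
    have fin: "finite V" by (simp add: V_def finite_columns finite_rows)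
    obtain e :: "vertex \<Rightarrow> nat" where e: "inj_on e V"
      using finite_imp_inj_to_nat_seg[OF fin] by blast
    let ?G = "graph_on V adj e" and ?X = "e ` columns m d"
    have "inj_on e (columns m d)" using e by (rule inj_on_subset) (simp add: V_def)
    then have X: "card ?X = k" using k by (simp add: card_image card_columns m_def)
    have "V \<noteq> {}" using X k by (auto simp: V_def)
    have "1 / 8 * real d * 2 ^ d * real k \<le> real ((m - d) * (d * 2 ^ (d - 2)))"
    proof (cases "d = 0")
      case False
      \<comment> \<open>For \<open>d = 1\<close> the truncated exponent \<open>d - 2\<close> is \<open>0\<close>, and the bound still holds.\<close>
      have pow: "(2::real) ^ d \<le> 4 * 2 ^ (d - 2)"
      proof (cases "d \<ge> 2")
        case True
        then have "d = 2 + (d - 2)" by simp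
        then have "(2::real) ^ d = 2 ^ 2 * 2 ^ (d - 2)" by (metis power_add)
        then show ?thesis by simp
      next
        case False
        then show ?thesis using \<open>d \<noteq> 0\<close> by (simp add: not_le less_2_cases_iff)
      qed
      have "real k \<le> 2 * real (m - d)" using k by (simp add: m_def)
      then have "2 ^ d * real k \<le> (4 * 2 ^ (d - 2)) * (2 * real (m - d))"
        using pow by (intro mult_mono) auto
      then have "real d * (2 ^ d * real k) \<le> real d * ((4 * 2 ^ (d - 2)) * (2 * real (m - d)))"
        by (rule mult_left_mono) simp
      then show ?thesis by (simp add: ac_simps)
    qed simp
    also have "\<dots> \<le> real (card (nbhds_on ?G ?X))"
      using card_nbhds_rows_columns[of e m d] e unfolding V_def of_nat_le_iff by blast
    finally have "1 / 8 * real d * 2 ^ d * real (card ?X) \<le> real (card (nbhds_on ?G ?X))"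
      using X by simp
    moreover have "?X \<subseteq> verts ?G" by (auto simp: graph_on_def V_def)
    moreover have "simple_graph ?G" using fin e irreflp_adj by (rule simple_graph_on)
    moreover have "bipartite ?G" using e bipartite_rows_columns unfolding V_def by blast
    moreover have "twin_width ?G \<le> d"
      using e \<open>V \<noteq> {}\<close> twin_width_rows_columns unfolding V_def by blast
    ultimately show ?thesis using X by blast
  qed
  \<comment> \<open>The constant factor \<open>c = 1 / 8\<close> moves into the exponent as \<open>\<theta> = log 2 c\<close>.\<close>
  have exponent: "1 / 8 * real d * 2 ^ d * real n
      = 2 powr (real d + log 2 (real d) + log 2 (1 / 8)) * real n" if "d \<ge> 1" for d n :: nat
    using that by (simp add: powr_add powr_realpow)
  show ?thesis
  proof (rule exI[of _ "1 / 8"], rule conjI, simp, rule exI[of _ "\<bar>log 2 (1 / 8)\<bar>"], rule allI)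
    fix d :: nat
    show "\<exists>k0::nat. k0 \<ge> 1 \<and> (\<forall>k\<ge>k0.
      \<exists>(G :: nat graph) X.
        simple_graph G \<and> bipartite G \<and> twin_width G \<le> d \<and>
        X \<subseteq> verts G \<and> card X = k \<and>
        real (card (nbhds_on G X)) \<ge> 1 / 8 * real d * 2 ^ d * real (card X) \<and>
        (d \<ge> 1 \<longrightarrow> (\<exists>\<theta>::real. \<bar>\<theta>\<bar> \<le> \<bar>log 2 (1 / 8)\<bar> \<and>
          1 / 8 * real d * 2 ^ d * real (card X)
            = 2 powr (real d + log 2 (real d) + \<theta>) * real (card X))))"
    proof (intro exI[of _ "4 * d + 1"] conjI allI impI)
      fix k assume "4 * d + 1 \<le> k"
      then obtain G :: "nat graph" and X where GX: "simple_graph G" "bipartite G"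
        "twin_width G \<le> d" "X \<subseteq> verts G" "card X = k"
        "real (card (nbhds_on G X)) \<ge> 1 / 8 * real d * 2 ^ d * real (card X)"
        using main[of d k] by blast
      show "\<exists>(G :: nat graph) X.
        simple_graph G \<and> bipartite G \<and> twin_width G \<le> d \<and>
        X \<subseteq> verts G \<and> card X = k \<and>
        real (card (nbhds_on G X)) \<ge> 1 / 8 * real d * 2 ^ d * real (card X) \<and>
        (d \<ge> 1 \<longrightarrow> (\<exists>\<theta>::real. \<bar>\<theta>\<bar> \<le> \<bar>log 2 (1 / 8)\<bar> \<and>
          1 / 8 * real d * 2 ^ d * real (card X)
            = 2 powr (real d + log 2 (real d) + \<theta>) * real (card X)))"
        using GX exponent[of d "card X"]
        by (intro exI[of _ G] exI[of _ X] conjI impI exI[of _ "log 2 (1 / 8)"]) simp_all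
    qed simp
  qed
qed

end
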